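(* Let $\mathbb{F}$ be a field of characteristic not two and let $A$ be a primitive axial algebra of Jordan type half over $\mathbb{F}$ generated by three primitive axes $x_0$, $y_0$, $z_0$, with its Frobenius form $(\cdot,\cdot)$. If $(x_0,y_0)=\alpha$, $(y_0,z_0)=\beta$, $(x_0,z_0)=\gamma$ and $(x_0,y_0z_0)=\psi$, then $A$ is a homomorphic image of the algebra $A(\alpha,\beta,\gamma,\psi)$.
   Context: Algebras are not assumed associative. For a commutative $\mathbb{F}$-algebra $A$, $u\in A$ and $\lambda\in\mathbb{F}$, let $ad_u: x\mapsto xu$ and let $A_\lambda(u)$ be the $\lambda$-eigenspace of $ad_u$ (possibly zero). $A$ is an axial algebra of Jordan type half if, with $\eta=\frac12$, it is generated (as an algebra) by a set $X$ of idempotents (called axes) such that for each $u\in X$: the minimal polynomial of $ad_u$ divides $(x-1)x(x-\eta)$, so $A=A_1(u)\oplus A_0(u)\oplus A_\eta(u)$, and $A_1(u)A_1(u)\subseteq A_1(u)$, $A_0(u)A_0(u)\subseteq A_0(u)$, $A_1(u)A_0(u)=\{0\}$, $(A_0(u)+A_1(u))A_\eta(u)\subseteq A_\eta(u)$, $A_\eta(u)A_\eta(u)\subseteq A_0(u)+A_1(u)$. An axis $u$ is primitive if $A_1(u)=\langle u\rangle$ is 1-dimensional; $A$ is primitive if all axes in $X$ are. In the claim $X=\{x_0,y_0,z_0\}$. For a primitive axis $u$ and $v\in A$, $\varphi_u(v)\in\mathbb{F}$ is the scalar such that the projection of $v$ on $A_1(u)$ along $A_0(u)\oplus A_\eta(u)$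 equals $\varphi_u(v)u$. A Frobenius form is a non-zero bilinear form with $(uv,w)=(u,vw)$ for all $u,v,w$. It is known that a primitive axial algebra of Jordan type $\eta$ generated by a set $X$ of primitive axes has a unique Frobenius form such that $(u,v)=\varphi_u(v)$ for all $u\in X$, $v\in A$, $(u,u)=1$ for $u\in X$, and the form is invariant under automorphisms of $A$; it is symmetric. This is "the Frobenius form" of $A$. Definition of $A(\alpha,\beta,\gamma,\psi)$: it is the commutative $\mathbb{F}$-algebra on a 9-dimensional $\mathbb{F}$-vector space with basis $e_1,\dots,e_9$, which are denoted respectively by the symbols $a,\ b,\ c,\ ab,\ bc,\ ac,\ a(bc),\ b(ac),\ c(ab)$ (as symbols, $xy$ and $yx$ are identified, and $x(yz)$ and $x(zy)$ are identified). Put $\lambda_{ab}=\lambda_{ba}=\alpha$, $\lambda_{bc}=\lambda_{cb}=\beta$, $\lambda_{ac}=\lambda_{ca}=\gamma$. The (commutative, bilinear) product $\cdot$ is given by the following formulas for every permutation $(x,y,z)$ of $(a,b,c)$: (1) $x\cdot x=x$, $\ x\cdot y=xy$, $\ x\cdot yz=x(yz)$; (2) $x\cdot xy=\frac12(\lambda_{xy}x+xy)$; (3) $x\cdot x(yz)=\frac12(\psi x+x(yz))$; (4) $x\cdot y(xz)=\frac14(\psi x+\lambda_{xz}\,xy+\lambda_{xy}\,xz+x(yz)+y(xz)-z(xy))$; (5) $xy\cdot xy=\frac{\lambda_{xy}}{4}(x+y)+\frac{\lambda_{xy}}{2}xy$; (6) $xy\cdot xz=\frac14(\psi x+\lambda_{xz}\,xy+\lambda_{xy}\,xz-x(yz)+y(xz)+z(xy))$;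 (7) $xy\cdot x(yz)=\frac18((\lambda_{xy}\lambda_{yz}+\psi)x+\psi y+2\psi\,xy+\lambda_{xy}\,yz+2\lambda_{xy}\,x(yz))$; (8) $xy\cdot z(xy)=\frac18(\lambda_{xy}\lambda_{yz}x+\lambda_{xy}\lambda_{xz}y+4\psi\,xy+\lambda_{xy}\,yz+\lambda_{xy}\,xz-2\lambda_{xy}\,x(yz)-2\lambda_{xy}\,y(xz)+4\lambda_{xy}\,z(xy))$; (9) $(x(yz))^2=\frac1{16}(\lambda_{yz}(\lambda_{xy}+\lambda_{xz}+2\psi)x+\lambda_{yz}\lambda_{xz}y+\lambda_{yz}\lambda_{xy}z+4\psi\,yz+(2\lambda_{yz}+8\psi)\,x(yz)-2\lambda_{yz}\,y(xz)-2\lambda_{yz}\,z(xy))$; (10) $x(yz)\cdot y(xz)=\frac1{16}(\lambda_{yz}(\lambda_{xz}+\psi)x+\lambda_{xz}(\lambda_{yz}+\psi)y+\lambda_{xy}\psi z+2\psi\,xy+2(\lambda_{xy}\lambda_{xz}+\psi)yz+2(\lambda_{xy}\lambda_{yz}+\psi)xz+(4\psi-\lambda_{xy}+\lambda_{yz}-\lambda_{xz})x(yz)+(4\psi-\lambda_{xy}-\lambda_{yz}+\lambda_{xz})y(xz)+(\lambda_{xy}-\lambda_{yz}-\lambda_{xz}-4\psi)z(xy))$. *)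

theory Defs
  imports
    "HOL-Analysis.Analysis"
    "HOL-Computational_Algebra.Polynomial"
    "HOL-Library.Set_Algebras"
begin

section \<open>Commutative algebras and axial algebras of Jordan type\<close>

locale comm_algebra = vector_space scale
  for scale :: "'f::field \<Rightarrow> 'a::ab_group_add \<Rightarrow> 'a" +
  fixes mult :: "'a \<Rightarrow> 'a \<Rightarrow> 'a"
  assumes mult_commute: "mult x y = mult y x"
    and mult_add_left: "mult (x + y) z = mult x z + mult y z"
    and mult_scale_left: "mult (scale r x) y = scale r (mult x y)"
begin

definition poly_endo :: "'f poly \<Rightarrow> ('a \<Rightarrow> 'a) \<Rightarrow> 'a \<Rightarrow> 'a" where
  "poly_endo p f v = (\<Sum>i\<le>degree p. scale (coeff p i) ((f ^^ i) v))"

text \<open>On an infinite-dimensional space a minimal polynomial need not exist, so it is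
  a relation rather than a function.\<close>

definition is_minimal_poly :: "('a \<Rightarrow> 'a) \<Rightarrow> 'f poly \<Rightarrow> bool" where
  "is_minimal_poly f p \<longleftrightarrow>
     lead_coeff p = 1 \<and> (\<forall>v. poly_endo p f v = 0) \<and>
     (\<forall>q. q \<noteq> 0 \<and> (\<forall>v. poly_endo q f v = 0) \<longrightarrow> degree p \<le> degree q)"

definition ad :: "'a \<Rightarrow> 'a \<Rightarrow> 'a" where
  "ad u x = mult x u"

definition eigenspace :: "'a \<Rightarrow> 'f \<Rightarrow> 'a set" where
  "eigenspace u l = {x. ad u x = scale l x}"

definition mult_sets :: "'a set \<Rightarrow> 'a set \<Rightarrow> 'a set" where
  "mult_sets S T = {mult x y | x y. x \<in> S \<and> y \<in> T}"

definition subalgebra :: "'a set \<Rightarrow> bool" where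
  "subalgebra S \<longleftrightarrow> subspace S \<and> mult_sets S S \<subseteq> S"

definition generates :: "'a set \<Rightarrow> bool" where
  "generates X \<longleftrightarrow> subalgebra hull X = UNIV"

definition jordan_axis :: "'f \<Rightarrow> 'a \<Rightarrow> bool" where
  "jordan_axis \<eta> u \<longleftrightarrow>
     mult u u = u \<and>
     (\<exists>p. is_minimal_poly (ad u) p \<and> p dvd [:-1, 1:] * [:0, 1:] * [:-\<eta>, 1:]) \<and>
     mult_sets (eigenspace u 1) (eigenspace u 1) \<subseteq> eigenspace u 1 \<and>
     mult_sets (eigenspace u 0) (eigenspace u 0) \<subseteq> eigenspace u 0 \<and>
     mult_sets (eigenspace u 1) (eigenspace u 0) = {0} \<and>
     mult_sets (eigenspace u 0 + eigenspace u 1) (eigenspace u \<eta>) \<subseteq> eigenspace u \<eta> \<and>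
     mult_sets (eigenspace u \<eta>) (eigenspace u \<eta>) \<subseteq> eigenspace u 0 + eigenspace u 1"

definition axial_algebra_jordan :: "'f \<Rightarrow> 'a set \<Rightarrow> bool" where
  "axial_algebra_jordan \<eta> X \<longleftrightarrow> generates X \<and> (\<forall>u\<in>X. jordan_axis \<eta> u)"

definition primitive :: "'a \<Rightarrow> bool" where
  "primitive u \<longleftrightarrow> eigenspace u 1 = span {u} \<and> dim (eigenspace u 1) = 1"

definition primitive_axial_algebra_jordan :: "'f \<Rightarrow> 'a set \<Rightarrow> bool" where
  "primitive_axial_algebra_jordan \<eta> X \<longleftrightarrow>
     axial_algebra_jordan \<eta> X \<and> (\<forall>u\<in>X. primitive u)"

text \<open>The coefficient at \<open>u\<close> of the projection of \<open>v\<close> onto the 1-eigenspace along the sum of the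
  0- and \<open>\<eta>\<close>-eigenspaces; only meaningful for a primitive axis \<open>u\<close>, with \<open>\<eta>\<close> different from 0
  and 1.\<close>

definition axis_proj :: "'f \<Rightarrow> 'a \<Rightarrow> 'a \<Rightarrow> 'f" where
  "axis_proj \<eta> u v =
     (THE c. \<exists>w \<in> eigenspace u 0 + eigenspace u \<eta>. v = scale c u + w)"

definition frobenius_form :: "('a \<Rightarrow> 'a \<Rightarrow> 'f) \<Rightarrow> bool" where
  "frobenius_form form \<longleftrightarrow>
     (\<forall>u. Vector_Spaces.linear scale (*) (\<lambda>v. form u v)) \<and>
     (\<forall>v. Vector_Spaces.linear scale (*) (\<lambda>u. form u v)) \<and>
     (\<exists>u v. form u v \<noteq> 0) \<and>
     (\<forall>u v w. form (mult u v) w = form u (mult v w))"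

text \<open>When \<open>X\<close> is a generating set of primitive axes, at most one form satisfies the following:
  associativity propagates the prescribed values from \<open>X\<close> to the generated subalgebra.\<close>

definition the_frobenius_form :: "'f \<Rightarrow> 'a set \<Rightarrow> ('a \<Rightarrow> 'a \<Rightarrow> 'f) \<Rightarrow> bool" where
  "the_frobenius_form \<eta> X form \<longleftrightarrow>
     frobenius_form form \<and>
     (\<forall>u\<in>X. \<forall>v. form u v = axis_proj \<eta> u v) \<and>
     (\<forall>u\<in>X. form u u = 1)"

end

definition homomorphic_image ::
  "('f::field \<Rightarrow> 'a::ab_group_add \<Rightarrow> 'a) \<Rightarrow> ('a \<Rightarrow> 'a \<Rightarrow> 'a) \<Rightarrow>
   ('f \<Rightarrow> 'b::ab_group_add \<Rightarrow> 'b) \<Rightarrow> ('b \<Rightarrow> 'b \<Rightarrow> 'b) \<Rightarrow> bool" where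
  "homomorphic_image scaleA multA scaleB multB \<longleftrightarrow>
     (\<exists>h. Vector_Spaces.linear scaleB scaleA h \<and>
          (\<forall>u v. h (multB u v) = multA (h u) (h v)) \<and> surj h)"


section \<open>The nine-dimensional algebra\<close>

datatype letter = La | Lb | Lc

lemma UNIV_letter: "UNIV = {La, Lb, Lc}"
  using letter.exhaust by auto

instance letter :: finite
  by standard (simp add: UNIV_letter)

text \<open>Since \<open>xy = yx\<close> as symbols, a product of two distinct letters is determined by the missing
  letter, and \<open>x(yz) = x(zy)\<close> by its outer letter \<open>x\<close>: for \<open>x, y, z\<close> distinct, \<open>Pair_without z\<close>
  stands for \<open>xy\<close> and \<open>Triple x\<close> for \<open>x(yz)\<close>.\<close>

datatype symb = Single letter | Pair_without letter | Triple letter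

lemma UNIV_symb: "UNIV = range Single \<union> range Pair_without \<union> range Triple"
proof -
  have "x \<in> range Single \<union> range Pair_without \<union> range Triple" for x
    by (cases x) auto
  then show ?thesis by auto
qed

instance symb :: finite
  by standard (simp add: UNIV_symb)

fun next_letter :: "letter \<Rightarrow> letter" where
  "next_letter La = Lb"
| "next_letter Lb = Lc"
| "next_letter Lc = La"

definition third :: "letter \<Rightarrow> letter \<Rightarrow> letter" where
  "third x y = (if y = next_letter x then next_letter y else next_letter x)"

abbreviation e1 :: "letter \<Rightarrow> 'f::field ^ symb" where
  "e1 x \<equiv> axis (Single x) 1"

abbreviation e2 :: "letter \<Rightarrow> letter \<Rightarrow> 'f::field ^ symb" where
  "e2 x y \<equiv> axis (Pair_without (third x y)) 1"

abbreviation e3 :: "letter \<Rightarrow> 'f::field ^ symb" where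
  "e3 x \<equiv> axis (Triple x) 1"

context
  fixes \<alpha> \<beta> \<gamma> \<psi> :: "'f::field"
begin

definition lam :: "letter \<Rightarrow> letter \<Rightarrow> 'f" where
  "lam x y = (case third x y of Lc \<Rightarrow> \<alpha> | La \<Rightarrow> \<beta> | Lb \<Rightarrow> \<gamma>)"

text \<open>The formulas for \<open>xy \<cdot> xy\<close>, \<open>xy \<cdot> z(xy)\<close> and \<open>x(yz) \<cdot> x(yz)\<close> are symmetric in the two letters
  that the symbol leaves unordered, so \<open>next_letter\<close> is used to pick an order.  The lemmas \<open>prod9_1\<close>
  to \<open>prod9_10\<close> give the resulting products for all permutations of the letters.\<close>

function basis_prod :: "symb \<Rightarrow> symb \<Rightarrow> 'f ^ symb" where
  "basis_prod (Single x) (Single y) = (if x = y then e1 x else e2 x y)"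
| "basis_prod (Single x) (Pair_without w) =
     (if x = w then e3 x
      else let y = third x w in (1/2) *s (lam x y *s e1 x + e2 x y))"
| "basis_prod (Single x) (Triple y) =
     (if x = y then (1/2) *s (\<psi> *s e1 x + e3 x)
      else let z = third x y in
        (1/4) *s (\<psi> *s e1 x + lam x z *s e2 x y + lam x y *s e2 x z + e3 x + e3 y - e3 z))"
| "basis_prod (Pair_without v) (Pair_without w) =
     (if v = w then
        let x = next_letter v; y = third x v in
          (lam x y / 4) *s (e1 x + e1 y) + (lam x y / 2) *s e2 x y
      else
        let x = third v w; y = w; z = v in
          (1/4) *s (\<psi> *s e1 x + lam x z *s e2 x y + lam x y *s e2 x z - e3 x + e3 y + e3 z))"
| "basis_prod (Pair_without w) (Triple x) =
     (if x = w then
        let z = w; x = next_letter z; y = third x z in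
          (1/8) *s ((lam x y * lam y z) *s e1 x + (lam x y * lam x z) *s e1 y
            + (4 * \<psi>) *s e2 x y + lam x y *s e2 y z + lam x y *s e2 x z
            - (2 * lam x y) *s e3 x - (2 * lam x y) *s e3 y + (4 * lam x y) *s e3 z)
      else
        let z = w; y = third x z in
          (1/8) *s ((lam x y * lam y z + \<psi>) *s e1 x + \<psi> *s e1 y + (2 * \<psi>) *s e2 x y
            + lam x y *s e2 y z + (2 * lam x y) *s e3 x))"
| "basis_prod (Triple x) (Triple y) =
     (if x = y then
        let y = next_letter x; z = third x y in
          (1/16) *s ((lam y z * (lam x y + lam x z + 2 * \<psi>)) *s e1 x
            + (lam y z * lam x z) *s e1 y + (lam y z * lam x y) *s e1 z
            + (4 * \<psi>) *s e2 y z + (2 * lam y z + 8 * \<psi>) *s e3 x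
            - (2 * lam y z) *s e3 y - (2 * lam y z) *s e3 z)
      else
        let z = third x y in
          (1/16) *s ((lam y z * (lam x z + \<psi>)) *s e1 x + (lam x z * (lam y z + \<psi>)) *s e1 y
            + (lam x y * \<psi>) *s e1 z + (2 * \<psi>) *s e2 x y
            + (2 * (lam x y * lam x z + \<psi>)) *s e2 y z
            + (2 * (lam x y * lam y z + \<psi>)) *s e2 x z
            + (4 * \<psi> - lam x y + lam y z - lam x z) *s e3 x
            + (4 * \<psi> - lam x y - lam y z + lam x z) *s e3 y
            + (lam x y - lam y z - lam x z - 4 * \<psi>) *s e3 z))"
| "basis_prod (Pair_without w) (Single x) = basis_prod (Single x) (Pair_without w)"
| "basis_prod (Triple y) (Single x) = basis_prod (Single x) (Triple y)"
| "basis_prod (Triple x) (Pair_without w) = basis_prod (Pair_without w) (Triple x)"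
  by pat_completeness auto
termination
  by (relation "Wellfounded.measure (\<lambda>(i, j).
        case (i, j) of
          (Pair_without _, Single _) \<Rightarrow> 1
        | (Triple _, Single _) \<Rightarrow> 1
        | (Triple _, Pair_without _) \<Rightarrow> 1
        | _ \<Rightarrow> 0)") auto

definition prod9 :: "'f ^ symb \<Rightarrow> 'f ^ symb \<Rightarrow> 'f ^ symb" where
  "prod9 u v = (\<Sum>i\<in>UNIV. \<Sum>j\<in>UNIV. (u $ i * v $ j) *s basis_prod i j)"

end


lemma third_commute: "x \<noteq> y \<Longrightarrow> third x y = third y x"
  by (cases x; cases y) (simp_all add: third_def)

lemma third_distinct: "distinct [x, y, z] \<Longrightarrow> third x y = z"
  by (cases x; cases y; cases z) (simp_all add: third_def)

lemma lam_values:
  "lam \<alpha> \<beta> \<gamma> La Lb = \<alpha>" "lam \<alpha> \<beta> \<gamma> Lb La = \<alpha>"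
  "lam \<alpha> \<beta> \<gamma> Lb Lc = \<beta>" "lam \<alpha> \<beta> \<gamma> Lc Lb = \<beta>"
  "lam \<alpha> \<beta> \<gamma> La Lc = \<gamma>" "lam \<alpha> \<beta> \<gamma> Lc La = \<gamma>"
  by (simp_all add: lam_def third_def)

lemma basis_prod_commute: "basis_prod \<alpha> \<beta> \<gamma> \<psi> i j = basis_prod \<alpha> \<beta> \<gamma> \<psi> j i"
proof (cases i; cases j)
  fix x y assume *: "i = Single x" "j = Single y"
  show ?thesis by (cases x; cases y) (simp_all add: * third_def)
next
  fix x y assume *: "i = Pair_without x" "j = Pair_without y"
  show ?thesis
    by (cases x; cases y) (simp_all add: * third_def lam_def Let_def ac_simps diff_conv_add_uminus
      del: add_uminus_conv_diff uminus_add_conv_diff)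
next
  fix x y assume *: "i = Triple x" "j = Triple y"
  show ?thesis
    by (cases x; cases y) (simp_all add: * third_def lam_def Let_def ac_simps diff_conv_add_uminus
      del: add_uminus_conv_diff uminus_add_conv_diff)
qed simp_all

lemma prod9_commute: "prod9 \<alpha> \<beta> \<gamma> \<psi> u v = prod9 \<alpha> \<beta> \<gamma> \<psi> v u"
  unfolding prod9_def
  by (subst sum.swap) (simp add: mult.commute basis_prod_commute[of \<alpha> \<beta> \<gamma> \<psi>])

lemma comm_algebra_prod9:
  fixes \<alpha> \<beta> \<gamma> \<psi> :: "'f::field"
  shows "comm_algebra (*s) (prod9 \<alpha> \<beta> \<gamma> \<psi>)"
proof unfold_locales
  fix u v w :: "'f ^ symb" and r :: 'f
  show "prod9 \<alpha> \<beta> \<gamma> \<psi> u v = prod9 \<alpha> \<beta> \<gamma> \<psi> v u"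
    by (rule prod9_commute)
  show "prod9 \<alpha> \<beta> \<gamma> \<psi> (u + v) w = prod9 \<alpha> \<beta> \<gamma> \<psi> u w + prod9 \<alpha> \<beta> \<gamma> \<psi> v w"
    by (simp add: prod9_def distrib_right vec.scale_left_distrib sum.distrib)
  show "prod9 \<alpha> \<beta> \<gamma> \<psi> (r *s u) v = r *s prod9 \<alpha> \<beta> \<gamma> \<psi> u v"
    by (simp add: prod9_def vec.scale_sum_right mult.assoc)
qed

lemma prod9_axis: "prod9 \<alpha> \<beta> \<gamma> \<psi> (axis i 1) (axis j 1) = basis_prod \<alpha> \<beta> \<gamma> \<psi> i j"
proof -
  have "prod9 \<alpha> \<beta> \<gamma> \<psi> (axis i 1) (axis j 1) =
      (\<Sum>k\<in>UNIV. \<Sum>l\<in>UNIV. if k = i then (if l = j then basis_prod \<alpha> \<beta> \<gamma> \<psi> k l else 0) else 0)"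
    unfolding prod9_def by (intro sum.cong refl) (simp add: axis_def)
  also have "\<dots> = (\<Sum>k\<in>UNIV. if k = i then basis_prod \<alpha> \<beta> \<gamma> \<psi> k j else 0)"
    by (intro sum.cong refl) simp
  finally show ?thesis by simp
qed

context
  fixes \<alpha> \<beta> \<gamma> \<psi> :: "'f::field" and x y z :: letter
  assumes distinct: "distinct [x, y, z]"
begin

private abbreviation (input) prd (infixl "\<star>" 75) where "u \<star> v \<equiv> prod9 \<alpha> \<beta> \<gamma> \<psi> u v"
private abbreviation (input) l where "l \<equiv> lam \<alpha> \<beta> \<gamma>"

lemma prod9_1: "e1 x \<star> e1 x = e1 x" "e1 x \<star> e1 y = e2 x y" "e1 x \<star> e2 y z = e3 x"
  using distinct by (cases x; cases y; cases z; simp add: prod9_axis third_def)+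

lemma prod9_2: "e1 x \<star> e2 x y = (1/2) *s (l x y *s e1 x + e2 x y)"
  using distinct by (cases x; cases y; cases z; simp add: prod9_axis third_def)

lemma prod9_3: "e1 x \<star> e3 x = (1/2) *s (\<psi> *s e1 x + e3 x)"
  by (simp add: prod9_axis)

lemma prod9_4: "e1 x \<star> e3 y =
    (1/4) *s (\<psi> *s e1 x + l x z *s e2 x y + l x y *s e2 x z + e3 x + e3 y - e3 z)"
  using distinct by (cases x; cases y; cases z; simp add: prod9_axis third_def)

lemma prod9_5: "e2 x y \<star> e2 x y = (l x y / 4) *s (e1 x + e1 y) + (l x y / 2) *s e2 x y"
  using distinct
  by (cases x; cases y; cases z; simp add: prod9_axis third_def lam_def Let_def add.commute)

lemma prod9_6: "e2 x y \<star> e2 x z =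
    (1/4) *s (\<psi> *s e1 x + l x z *s e2 x y + l x y *s e2 x z - e3 x + e3 y + e3 z)"
  using distinct
  by (cases x; cases y; cases z; simp add: prod9_axis third_def lam_def Let_def)

lemma prod9_7: "e2 x y \<star> e3 x =
    (1/8) *s ((l x y * l y z + \<psi>) *s e1 x + \<psi> *s e1 y + (2 * \<psi>) *s e2 x y
      + l x y *s e2 y z + (2 * l x y) *s e3 x)"
  using distinct
  by (cases x; cases y; cases z; simp add: prod9_axis third_def lam_def Let_def)

lemma prod9_8: "e2 x y \<star> e3 z =
    (1/8) *s ((l x y * l y z) *s e1 x + (l x y * l x z) *s e1 y
      + (4 * \<psi>) *s e2 x y + l x y *s e2 y z + l x y *s e2 x z
      - (2 * l x y) *s e3 x - (2 * l x y) *s e3 y + (4 * l x y) *s e3 z)"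
  using distinct
  by (cases x; cases y; cases z; simp add: prod9_axis third_def lam_def Let_def ac_simps diff_conv_add_uminus
      del: add_uminus_conv_diff uminus_add_conv_diff)

lemma prod9_9: "e3 x \<star> e3 x =
    (1/16) *s ((l y z * (l x y + l x z + 2 * \<psi>)) *s e1 x
      + (l y z * l x z) *s e1 y + (l y z * l x y) *s e1 z
      + (4 * \<psi>) *s e2 y z + (2 * l y z + 8 * \<psi>) *s e3 x
      - (2 * l y z) *s e3 y - (2 * l y z) *s e3 z)"
  using distinct
  by (cases x; cases y; cases z; simp add: prod9_axis third_def lam_def Let_def ac_simps diff_conv_add_uminus
      del: add_uminus_conv_diff uminus_add_conv_diff)

lemma prod9_10: "e3 x \<star> e3 y =
    (1/16) *s ((l y z * (l x z + \<psi>)) *s e1 x + (l x z * (l y z + \<psi>)) *s e1 y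
      + (l x y * \<psi>) *s e1 z + (2 * \<psi>) *s e2 x y
      + (2 * (l x y * l x z + \<psi>)) *s e2 y z + (2 * (l x y * l y z + \<psi>)) *s e2 x z
      + (4 * \<psi> - l x y + l y z - l x z) *s e3 x
      + (4 * \<psi> - l x y - l y z + l x z) *s e3 y
      + (l x y - l y z - l x z - 4 * \<psi>) *s e3 z)"
  using distinct
  by (cases x; cases y; cases z; simp add: prod9_axis third_def lam_def Let_def)

end

end

theory Submission
  imports Defs
begin

text \<open>
  For a primitive axis \<open>u\<close>, every \<open>v\<close> splits as \<open>(u, v) u + v\<^sub>0 + v\<^sub>h\<close> with
  \<open>v\<^sub>h = uv - (u, v) u\<close> and \<open>v\<^sub>0 = v + (u, v) u - 2 uv\<close>. Writing the fusion rules for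
  \<open>v\<^sub>0 w\<^sub>0\<close>, \<open>v\<^sub>0 w\<^sub>h\<close>, \<open>v\<^sub>h w\<^sub>0\<close> and \<open>v\<^sub>h w\<^sub>h\<close> in these terms determines
  \<open>uv \<cdot> uw\<close> and \<open>u(v(uw))\<close>, for all \<open>v\<close> and \<open>w\<close>, as combinations of \<open>u\<close>, \<open>uv\<close>, \<open>uw\<close>,
  \<open>u(vw)\<close>, \<open>v(uw)\<close> and \<open>w(uv)\<close>. With \<open>v\<close> and \<open>w\<close> among the products of at most three of the
  generating axes, these two identities yield all products of the nine words in the generators,
  so the nine words satisfy the multiplication table of the nine-dimensional algebra.
\<close>

section \<open>Separation of vectors by linear functionals\<close>

context vector_space begin

text \<open>Coordinates with respect to a basis are linear functionals and determine a vector, in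
  any dimension.\<close>

lemma vector_eqI_functional:
  assumes "\<And>l. Vector_Spaces.linear scale (*) l \<Longrightarrow> l x = l y"
  shows "x = y"
proof -
  define B where "B = extend_basis {}"
  have B: "independent B" "span B = UNIV"
    unfolding B_def using independent_extend_basis[of "{}"] span_extend_basis[of "{}"]
    by (auto simp: independent_empty)
  have "representation B x b = representation B y b" for b
  proof (rule assms)
    show "Vector_Spaces.linear scale (*) (\<lambda>v. representation B v b)"
      by unfold_locales (simp_all add: B representation_add[OF B(1)] representation_scale[OF B(1)]
        distrib_left distrib_right)
  qed
  hence "representation B x = representation B y" by (rule ext)
  moreover have "(\<Sum>b | representation B v b \<noteq> 0. scale (representation B v b) b) = v" for v
    by (rule sum_nonzero_representation_eq[OF B(1)]) (simp add: B(2))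
  ultimately show ?thesis by metis
qed

text \<open>Separating vectors by linear functionals turns an identity between linear combinations of
  vectors into one between field elements, where \<open>field_simps\<close> applies.\<close>

lemma vector_eqI:
  assumes "\<And>l. (\<And>v w. l (v + w) = l v + l w) \<Longrightarrow> (\<And>v w. l (v - w) = l v - l w) \<Longrightarrow>
      (\<And>v. l (- v) = - l v) \<Longrightarrow> (\<And>c v. l (scale c v) = c * l v) \<Longrightarrow> l 0 = 0 \<Longrightarrow> l x = l y"
  shows "x = y"
proof (rule vector_eqI_functional)
  fix l assume "Vector_Spaces.linear scale (*) l"
  then interpret l: Vector_Spaces.linear scale "(*)" l .
  show "l x = l y"
    by (rule assms) (rule l.add l.diff l.neg l.scale l.zero)+
qed

end

section \<open>Bilinearity of the product and polynomials in \<open>ad u\<close>\<close>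

context comm_algebra begin

lemma mult_add_right: "mult x (y + z) = mult x y + mult x z"
  by (metis mult_commute mult_add_left)

lemma mult_scale_right: "mult x (scale r y) = scale r (mult x y)"
  by (metis mult_commute mult_scale_left)

lemma mult_minus_left: "mult (- x) y = - mult x y"
  using mult_scale_left[of "-1" x y] by simp

lemma mult_minus_right: "mult x (- y) = - mult x y"
  by (metis mult_commute mult_minus_left)

lemma mult_diff_left: "mult (x - y) z = mult x z - mult y z"
  using mult_add_left[of x "-y" z] by (simp add: mult_minus_left)

lemma mult_diff_right: "mult x (y - z) = mult x y - mult x z"
  by (metis mult_commute mult_diff_left)

lemmas mult_linear = mult_add_left mult_add_right mult_scale_left mult_scale_right
  mult_diff_left mult_diff_right mult_minus_left mult_minus_right

lemma mult_zero_left [simp]: "mult 0 x = 0"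
  using mult_scale_left[of 0 0 x] by simp

lemma mult_zero_right [simp]: "mult x 0 = 0"
  by (metis mult_commute mult_zero_left)

lemma mult_sum_left: "mult (\<Sum>i\<in>I. f i) y = (\<Sum>i\<in>I. mult (f i) y)"
  by (induction I rule: infinite_finite_induct) (simp_all add: mult_add_left)

lemma mult_sum_right: "mult y (\<Sum>i\<in>I. f i) = (\<Sum>i\<in>I. mult y (f i))"
  by (induction I rule: infinite_finite_induct) (simp_all add: mult_add_right)

lemma linear_ad: "Vector_Spaces.linear scale scale (ad u)"
  by unfold_locales (simp_all add: ad_def mult_linear)

text \<open>Coefficients beyond the degree vanish, so polynomials of different degrees can be
  evaluated over a common range of indices.\<close>

lemma poly_endo_bound:
  assumes "degree p \<le> n"
  shows "poly_endo p f v = (\<Sum>i\<le>n. scale (coeff p i) ((f ^^ i) v))"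
  unfolding poly_endo_def
  by (rule sum.mono_neutral_left) (use assms in \<open>auto simp: coeff_eq_0\<close>)

lemma poly_endo_0 [simp]: "poly_endo 0 f v = 0"
  by (simp add: poly_endo_def)

lemma poly_endo_pCons:
  assumes "Vector_Spaces.linear scale scale f"
  shows "poly_endo (pCons a p) f v = scale a v + f (poly_endo p f v)"
proof -
  interpret f: Vector_Spaces.linear scale scale f by fact
  have "poly_endo (pCons a p) f v
      = (\<Sum>i\<le>Suc (degree p). scale (coeff (pCons a p) i) ((f ^^ i) v))"
    by (rule poly_endo_bound) (simp add: degree_pCons_le)
  also have "\<dots> = scale a v + (\<Sum>i\<le>degree p. scale (coeff p i) ((f ^^ Suc i) v))"
    by (subst sum.atMost_Suc_shift) simp
  also have "\<dots> = scale a v + f (poly_endo p f v)"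
    by (simp add: poly_endo_def f.sum f.scale)
  finally show ?thesis .
qed

lemma poly_endo_add:
  assumes "Vector_Spaces.linear scale scale f"
  shows "poly_endo (p + q) f v = poly_endo p f v + poly_endo q f v"
proof -
  let ?n = "max (degree p) (degree q)"
  have "poly_endo (p + q) f v = (\<Sum>i\<le>?n. scale (coeff (p + q) i) ((f ^^ i) v))"
    by (rule poly_endo_bound) (rule degree_add_le_max)
  thus ?thesis
    by (simp add: poly_endo_bound[of p ?n] poly_endo_bound[of q ?n] scale_left_distrib sum.distrib)
qed

lemma poly_endo_smult:
  "poly_endo (smult c p) f v = scale c (poly_endo p f v)"
  by (subst poly_endo_bound[of _ "degree p"])
     (simp_all add: poly_endo_def scale_sum_right degree_smult_le)

text \<open>The polynomials annihilating \<open>f\<close> form an ideal; the induction runs over the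
  coefficients of the cofactor \<open>r\<close>.\<close>

lemma poly_endo_dvd_zero:
  assumes f: "Vector_Spaces.linear scale scale f"
    and "\<And>v. poly_endo p f v = 0" and "p dvd q"
  shows "poly_endo q f v = 0"
proof -
  interpret f: Vector_Spaces.linear scale scale f by fact
  have "poly_endo (r * p) f v = 0" for r
    by (induction r)
       (simp_all add: poly_endo_add[OF f] poly_endo_smult poly_endo_pCons[OF f] assms(2) f.zero)
  thus ?thesis using \<open>p dvd q\<close> by (metis dvd_def mult.commute)
qed

text \<open>The minimal polynomial divides (X - 1) X (X - \<eta>), so this cubic annihilates
  \<open>ad u\<close>.\<close>

lemma jordan_axis_cubic:
  assumes "jordan_axis \<eta> u"
  shows "mult u (mult u (mult u v)) = scale (1 + \<eta>) (mult u (mult u v)) - scale \<eta> (mult u v)"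
proof -
  from assms obtain p where p: "is_minimal_poly (ad u) p"
      "p dvd [:-1, 1:] * [:0, 1:] * [:-\<eta>, 1:]"
    unfolding jordan_axis_def by (elim conjE exE)
  have zero: "poly_endo ([:-1, 1:] * [:0, 1:] * [:-\<eta>, 1:]) (ad u) v = 0"
    by (rule poly_endo_dvd_zero[OF linear_ad _ p(2)]) (use p(1) in \<open>simp add: is_minimal_poly_def\<close>)
  have e: "[:-1, 1:] * [:0, 1:] * [:-\<eta>, 1:] = [:0, \<eta>, - (1 + \<eta>), 1:]"
    by simp
  have ad: "ad u w = mult u w" for w
    by (simp add: ad_def mult_commute)
  have "poly_endo [:0, \<eta>, - (1 + \<eta>), 1:] (ad u) v
      = mult u (scale \<eta> v + mult u (scale (- (1 + \<eta>)) v + mult u v))"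
    by (simp only: poly_endo_pCons[OF linear_ad] ad poly_endo_0 mult_zero_right scale_one
      scale_zero_left add_0_left add_0_right)
  with zero have "scale \<eta> (mult u v) - scale (1 + \<eta>) (mult u (mult u v))
      + mult u (mult u (mult u v)) = 0"
    by (simp only: e mult_linear scale_minus_left add.assoc diff_conv_add_uminus)
  thus ?thesis by (simp add: add_eq_0_iff)
qed

section \<open>Fusion rules for eigenvectors of an axis\<close>

lemma in_eigenspace: "v \<in> eigenspace u c \<longleftrightarrow> mult u v = scale c v"
  by (simp add: eigenspace_def ad_def mult_commute)

lemma fusion_zero_zero:
  assumes "jordan_axis \<eta> u" "mult u v = 0" "mult u w = 0"
  shows "mult u (mult v w) = 0"
proof -
  have "v \<in> eigenspace u 0" "w \<in> eigenspace u 0"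
    using assms by (simp_all add: in_eigenspace)
  hence "mult v w \<in> mult_sets (eigenspace u 0) (eigenspace u 0)"
    by (auto simp: mult_sets_def)
  moreover have "mult_sets (eigenspace u 0) (eigenspace u 0) \<subseteq> eigenspace u 0"
    using assms(1) unfolding jordan_axis_def by (elim conjE)
  ultimately have "mult v w \<in> eigenspace u 0" by (rule rev_subsetD)
  thus ?thesis by (simp add: in_eigenspace)
qed

lemma fusion_zero_eta:
  assumes "jordan_axis \<eta> u" "mult u v = 0" "mult u w = scale \<eta> w"
  shows "mult u (mult v w) = scale \<eta> (mult v w)"
proof -
  have "v \<in> eigenspace u 0 + eigenspace u 1"
    \<comment> \<open>The summand in the 1-eigenspace is 0.\<close>
    by (rule set_plus_intro[of v _ 0, simplified]) (use assms in \<open>simp_all add: in_eigenspace\<close>)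
  moreover have "w \<in> eigenspace u \<eta>"
    using assms by (simp add: in_eigenspace)
  ultimately have "mult v w \<in> mult_sets (eigenspace u 0 + eigenspace u 1) (eigenspace u \<eta>)"
    by (auto simp: mult_sets_def)
  moreover have "mult_sets (eigenspace u 0 + eigenspace u 1) (eigenspace u \<eta>) \<subseteq> eigenspace u \<eta>"
    using assms(1) unfolding jordan_axis_def by (elim conjE)
  ultimately have "mult v w \<in> eigenspace u \<eta>" by (rule rev_subsetD)
  thus ?thesis by (simp add: in_eigenspace)
qed

lemma fusion_eta_eta:
  assumes "jordan_axis \<eta> u" "mult u v = scale \<eta> v" "mult u w = scale \<eta> w"
  obtains r s where "mult v w = r + s" "mult u r = 0" "mult u s = s"
proof -
  have "v \<in> eigenspace u \<eta>" "w \<in> eigenspace u \<eta>"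
    using assms by (simp_all add: in_eigenspace)
  hence "mult v w \<in> mult_sets (eigenspace u \<eta>) (eigenspace u \<eta>)"
    by (auto simp: mult_sets_def)
  moreover have "mult_sets (eigenspace u \<eta>) (eigenspace u \<eta>) \<subseteq> eigenspace u 0 + eigenspace u 1"
    using assms(1) unfolding jordan_axis_def by (elim conjE)
  ultimately have "mult v w \<in> eigenspace u 0 + eigenspace u 1" by (rule rev_subsetD)
  then obtain r s where "r \<in> eigenspace u 0" "s \<in> eigenspace u 1" "mult v w = r + s"
    by (rule set_plus_elim)
  thus ?thesis using that by (simp add: in_eigenspace)
qed

end

section \<open>Associative bilinear forms and primitive axes\<close>

locale algebra_with_form = comm_algebra scale mult
  for scale :: "'f::field \<Rightarrow> 'a::ab_group_add \<Rightarrow> 'a" and mult +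
  fixes form :: "'a \<Rightarrow> 'a \<Rightarrow> 'f"
  assumes form_linear_right: "Vector_Spaces.linear scale (*) (\<lambda>v. form u v)"
    and form_linear_left: "Vector_Spaces.linear scale (*) (\<lambda>u. form u v)"
    and form_assoc: "form (mult u v) w = form u (mult v w)"
    and two_neq_0: "(2::'f) \<noteq> 0"
begin

lemma form_linear:
  "form u (v + w) = form u v + form u w" "form u (v - w) = form u v - form u w"
  "form u (- v) = - form u v"
  "form u (scale c v) = c * form u v" "form u 0 = 0"
  "form (v + w) u = form v u + form w u" "form (v - w) u = form v u - form w u"
  "form (- v) u = - form v u"
  "form (scale c v) u = c * form v u" "form 0 u = 0"
proof -
  interpret r: Vector_Spaces.linear scale "(*)" "\<lambda>v. form u v" by (rule form_linear_right)
  interpret l: Vector_Spaces.linear scale "(*)" "\<lambda>v. form v u" by (rule form_linear_left)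
  show "form u (v + w) = form u v + form u w" "form u (v - w) = form u v - form u w"
    "form u (- v) = - form u v"
    "form u (scale c v) = c * form u v" "form u 0 = 0"
    "form (v + w) u = form v u + form w u" "form (v - w) u = form v u - form w u"
    "form (- v) u = - form v u"
    "form (scale c v) u = c * form v u" "form 0 u = 0"
    by (rule r.add r.diff r.neg r.scale r.zero l.add l.diff l.neg l.scale l.zero)+
qed

lemma half_neq_1: "(1::'f) / 2 \<noteq> 1"
proof
  assume "(1::'f) / 2 = 1"
  hence "(1::'f) = 2" using two_neq_0 by (simp add: divide_eq_eq)
  hence "1 + (0::'f) = 1 + 1" by (simp only: one_add_one add_0_right)
  thus False by (simp only: add_left_cancel zero_neq_one)
qed

text \<open>Reduces the non-vanishing of the denominators 4, 8 and 16 to that of 2.\<close>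

lemma numeral_Bit0_eq_0_iff: "(numeral (num.Bit0 n) :: 'f) = 0 \<longleftrightarrow> (numeral n :: 'f) = 0"
proof -
  have "(numeral (num.Bit0 n) :: 'f) = 2 * numeral n" by (metis mult_2 numeral_Bit0)
  thus ?thesis by (simp only: mult_eq_0_iff two_neq_0 simp_thms)
qed

lemmas numeral_simps = numeral_Bit0_eq_0_iff two_neq_0

text \<open>With \<open>form u u = 1\<close>, the value \<open>form u v\<close> is the coefficient
  at \<open>u\<close> of the component of \<open>v\<close> in the 1-eigenspace.\<close>

definition primitive_axis :: "'a \<Rightarrow> bool" where
  "primitive_axis u \<longleftrightarrow> jordan_axis (1/2) u \<and> primitive u \<and> form u u = 1"

context fixes u assumes u: "primitive_axis u" begin

lemma axis_idem: "mult u u = u"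
  using u by (simp add: primitive_axis_def jordan_axis_def)

text \<open>Since u = uu, associativity gives (u, v) = (u, uv) = c (u, v). The mirrored claim is
  proved separately because symmetry of the form is not yet available.\<close>

lemma form_axis_eigenvector:
  assumes "mult u v = scale c v" "c \<noteq> 1"
  shows "form u v = 0" "form v u = 0"
proof -
  have "form u v = form u (mult u v)"
    by (metis axis_idem form_assoc)
  hence "(1 - c) * form u v = 0" by (simp add: assms form_linear algebra_simps)
  thus "form u v = 0" using assms by simp
  have "form v u = form (mult u v) u"
    by (metis axis_idem form_assoc mult_commute)
  hence "(1 - c) * form v u = 0" by (simp add: assms form_linear algebra_simps)
  thus "form v u = 0" using assms by simp
qed

lemma axis_one_eigenvector:
  assumes "mult u v = v"
  shows "v = scale (form u v) u"
proof -
  have "v \<in> eigenspace u 1" using assms by (simp add: in_eigenspace)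
  hence "v \<in> span {u}" using u by (simp add: primitive_axis_def primitive_def)
  then obtain c where "v = scale c u" by (auto simp: span_singleton)
  thus ?thesis using u by (simp add: form_linear primitive_axis_def)
qed

lemma axis_absorb: "mult u (mult u v) = scale (1/2) (scale (form u v) u + mult u v)"
proof -
  let ?f = "mult u"
  have cubic: "?f (?f (?f v)) = scale (1 + 1/2) (?f (?f v)) - scale (1/2) (?f v)"
    using jordan_axis_cubic[of "1/2" u v] u by (simp add: primitive_axis_def)
  \<comment> \<open>The polynomial 2 X^2 - X is 1 at 1 and 0 at 0 and 1/2, so \<open>?v1\<close> is
    the projection of \<open>v\<close> to the 1-eigenspace.\<close>
  let ?v1 = "scale 2 (?f (?f v)) - ?f v"
  have "?f ?v1 = ?v1"
    by (rule vector_eqI; simp only: mult_linear cubic; simp (no_asm) add: field_simps numeral_simps)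
  hence "?v1 = scale (form u ?v1) u" by (rule axis_one_eigenvector)
  moreover have "form u (?f w) = form u w" for w
    by (metis form_assoc axis_idem)
  ultimately have eq: "?v1 = scale (form u v) u" by (simp add: form_linear)
  show ?thesis
  proof (rule vector_eqI)
    fix l :: "'a \<Rightarrow> 'f"
    assume l: "\<And>v w. l (v + w) = l v + l w" "\<And>v w. l (v - w) = l v - l w" "\<And>c v. l (scale c v) = c * l v"
    from arg_cong[OF eq, of l]
    show "l (mult u (mult u v)) = l (scale (1/2) (scale (form u v) u + mult u v))"
      by (simp add: l field_simps numeral_simps)
  qed
qed

text \<open>The vector uv - (u, v) u is a 1/2-eigenvector, hence pairs to 0 with u on the right,
  while (uv, u) = (v, uu) = (v, u).\<close>

lemma form_axis_commute: "form u v = form v u"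
proof -
  let ?w = "mult u v - scale (form u v) u"
  have "mult u ?w = scale (1/2) ?w"
    by (rule vector_eqI; simp only: mult_linear axis_absorb axis_idem; simp (no_asm) add: field_simps numeral_simps)
  hence "form ?w u = 0" using form_axis_eigenvector(2) half_neq_1 by blast
  moreover have "form u u = 1" using u by (simp add: primitive_axis_def)
  moreover have "form (mult u v) u = form v u"
    by (metis form_assoc axis_idem mult_commute)
  ultimately show ?thesis by (simp add: form_linear)
qed

end

text \<open>The vectors that commute with all others under the form are a subalgebra: (vv', w) = (v,
  v'w) = (v'w, v) = (v', wv) = (wv, v') = (w, vv').\<close>

lemma form_commute_if_generated:
  assumes "generates X" "\<And>u. u \<in> X \<Longrightarrow> primitive_axis u"
  shows "form v w = form w v"
proof -
  let ?S = "{v. \<forall>w. form v w = form w v}"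
  have "subspace ?S"
    by (auto simp: subspace_def form_linear)
  moreover have "form (mult v v') w = form w (mult v v')" if "v \<in> ?S" "v' \<in> ?S" for v v' w
    using that by (metis (mono_tags, lifting) form_assoc mem_Collect_eq mult_commute)
  ultimately have "subalgebra ?S"
    by (auto simp: subalgebra_def mult_sets_def)
  hence "subalgebra hull X \<subseteq> ?S"
    using assms(2) form_axis_commute by (intro hull_minimal) auto
  thus ?thesis using assms(1) by (auto simp: generates_def)
qed

end

section \<open>Products forced by the fusion rules of one axis\<close>

locale algebra_with_symmetric_form = algebra_with_form scale mult form
  for scale :: "'f::field \<Rightarrow> 'a::ab_group_add \<Rightarrow> 'a" and mult form +
  assumes form_commute: "form u v = form v u"
begin

context fixes u assumes u: "primitive_axis u" begin

lemma form_mult_axis: "form (mult u v) (mult u w) = (1/2) * (form u v * form u w + form u (mult v w))"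
proof -
  have "form (mult u v) (mult u w) = form v (mult u (mult u w))"
    by (metis form_assoc mult_commute)
  also have "form v u = form u v" "form v (mult u w) = form u (mult v w)"
    by (metis form_commute, metis form_assoc mult_commute)
  hence "form v (mult u (mult u w)) = (1/2) * (form u v * form u w + form u (mult v w))"
    by (simp add: axis_absorb[OF u] form_linear)
  finally show ?thesis .
qed

text \<open>The fusion rules are solved as a linear system: \<open>HH\<close> gives u(uv \<cdot>
  uw), the two instances of \<open>ZH\<close> express u(v(uw)) and u(w(uv)) through uv \<cdot> uw,
  and \<open>ZZ\<close> then determines uv \<cdot> uw.\<close>

lemma axis_fusion:
  shows axis_mult_mult: "mult u (mult v (mult u w)) =
      scale (1/4) (scale (form u (mult v w)) u + scale (form u w) (mult u v) + scale (form u v) (mult u w)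
        + mult u (mult v w) + mult v (mult u w) - mult w (mult u v))" (is ?mm)
    and axis_mult_prod: "mult (mult u v) (mult u w) =
      scale (1/4) (scale (form u (mult v w)) u + scale (form u w) (mult u v) + scale (form u v) (mult u w)
        - mult u (mult v w) + mult v (mult u w) + mult w (mult u v))" (is ?mp)
proof -
  \<comment> \<open>\<open>Z v\<close> is the component of \<open>v\<close> in the 0-eigenspace and
    \<open>H v\<close> is half of its component in the 1/2-eigenspace: v = (u, v) u + Z v + 2 H
    v.\<close>
  define Z where "Z v = v + scale (form u v) u - scale 2 (mult u v)" for v
  define H where "H v = mult u v - scale (form u v) u" for v
  have ax: "jordan_axis (1/2) u" using u by (simp add: primitive_axis_def)
  note absorb = axis_absorb[OF u] axis_idem[OF u]
  have Z: "mult u (Z v) = 0" for v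
    by (rule vector_eqI; simp only: Z_def mult_linear absorb; simp (no_asm) add: field_simps numeral_simps)
  have H: "mult u (H v) = scale (1/2) (H v)" for v
    by (rule vector_eqI; simp only: H_def mult_linear absorb; simp (no_asm) add: field_simps numeral_simps)
  have ZZ: "mult u (mult (Z v) (Z w)) = 0"
    by (rule fusion_zero_zero[OF ax Z Z])
  have ZH: "mult u (mult (Z v) (H w)) = scale (1/2) (mult (Z v) (H w))" for v w
    by (rule fusion_zero_eta[OF ax Z H])
  \<comment> \<open>Multiplication by \<open>u\<close> kills the 0-part of the product and fixes its
    1-part, which by primitivity is a multiple of \<open>u\<close> read off by the form.\<close>
  have "mult u (mult (H v) (H w)) = scale (form u (mult (H v) (H w))) u"
  proof -
    from fusion_eta_eta[OF ax H H, of v w] obtain r s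
      where rs: "mult (H v) (H w) = r + s" "mult u r = 0" "mult u s = s" .
    have "form u r = 0" using form_axis_eigenvector[OF u, of r 0] rs by simp
    thus ?thesis using axis_one_eigenvector[OF u rs(3)] rs by (simp add: mult_linear form_linear)
  qed
  also have "form u (mult (H v) (H w)) = (1/4) * (form u (mult v w) - form u v * form u w)"
  proof -
    have "form u (mult (H v) (H w)) = form (mult u (H v)) (H w)" by (simp add: form_assoc)
    also have "\<dots> = (1/2) * form (H v) (H w)" by (simp add: H form_linear)
    also have "form (H v) (H w) = (1/2) * (form u (mult v w) - form u v * form u w)"
    proof -
      have "form u (mult u w) = form u w" for w by (metis form_assoc absorb(2))
      moreover have "form (mult u w) u = form u w" for w by (metis calculation form_commute)
      moreover have "form u u = 1" using u by (simp add: primitive_axis_def)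
      ultimately show ?thesis by (simp add: H_def form_linear form_mult_axis field_simps numeral_simps)
    qed
    finally show ?thesis by simp
  qed
  finally have HH: "mult u (mult (H v) (H w)) = scale ((1/4) * (form u (mult v w) - form u v * form u w)) u" .
  have comm: "mult (mult u w) (mult u v) = mult (mult u v) (mult u w)"
     "mult (mult u w) v = mult v (mult u w)" "mult (mult u v) w = mult w (mult u v)" "mult v u = mult u v"
     "mult w u = mult u w" "mult (mult u v) u = mult u (mult u v)" "mult (mult u w) u = mult u (mult u w)"
     "mult w v = mult v w"
    by (rule mult_commute)+
  note exp = H_def Z_def mult_linear comm absorb
  define p q c where "p = form u v" and "q = form u w" and "c = form u (mult v w)"
  note exp = exp p_def[symmetric] q_def[symmetric] c_def[symmetric]
  have R: "mult u (mult (mult u v) (mult u w))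
      = scale (1/4) (scale (c + p * q) u + scale p (mult u w) + scale q (mult u v))" (is "_ = ?R")
  proof -
    have "mult u (mult (mult u v) (mult u w)) - ?R
        = mult u (mult (H v) (H w)) - scale ((1/4) * (form u (mult v w) - form u v * form u w)) u"
      unfolding exp
      by (rule vector_eqI; simp only:; simp (no_asm) add: field_simps numeral_simps)
    thus ?thesis by (simp add: HH)
  qed
  have N: "mult u (mult v (mult u w)) = scale (1/2) (scale c u + scale q (mult u v) + scale p (mult u w)
        + mult v (mult u w)) - mult (mult u v) (mult u w)" (is "_ = ?N")
  proof -
    have "mult u (mult v (mult u w)) - ?N
        = mult u (mult (Z v) (H w)) - scale (1/2) (mult (Z v) (H w))"
      unfolding exp R
      by (rule vector_eqI; simp only:; simp (no_asm) add: field_simps numeral_simps)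
    thus ?thesis by (simp add: ZH)
  qed
  have N': "mult u (mult w (mult u v)) = scale (1/2) (scale c u + scale q (mult u v) + scale p (mult u w)
        + mult w (mult u v)) - mult (mult u v) (mult u w)" (is "_ = ?N'")
  proof -
    have "mult u (mult w (mult u v)) - ?N'
        = mult u (mult (Z w) (H v)) - scale (1/2) (mult (Z w) (H v))"
      unfolding exp R
      by (rule vector_eqI; simp only:; simp (no_asm) add: field_simps numeral_simps)
    thus ?thesis by (simp add: ZH)
  qed
  \<comment> \<open>Four times \<open>R\<close> minus twice \<open>N\<close> and \<open>N'\<close>
    leaves 4 uv \<cdot> uw in the expansion of \<open>ZZ\<close>, whence the factor 1/4.\<close>
  show P: ?mp (is "?P = ?Q")
  proof -
    have "?P - ?Q = scale (1/4) (mult u (mult (Z v) (Z w)))"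
      unfolding exp R N N'
      by (rule vector_eqI; simp only:; simp (no_asm) add: field_simps numeral_simps)
    thus ?thesis by (simp add: ZZ)
  qed
  show ?mm unfolding N P unfolding exp
    by (rule vector_eqI; simp only:; simp (no_asm) add: field_simps numeral_simps)
qed

end

lemma form_axis_self: "primitive_axis u \<Longrightarrow> form u u = 1"
  by (simp add: primitive_axis_def)

lemma form_axis_mult: "primitive_axis u \<Longrightarrow> form u (mult u v) = form u v"
  by (metis form_assoc axis_idem)

lemma form_rotate: "form u (mult v w) = form w (mult u v)"
  by (metis form_assoc form_commute)

section \<open>The multiplication table of the nine words\<close>

context
  fixes x y z :: 'a
  assumes x: "primitive_axis x" and y: "primitive_axis y" and z: "primitive_axis z"
begin

text \<open>One instance of commutativity for each of the 36 pairs of distinct words, so that every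
  product has a single normal form.\<close>

lemma orient:
  "mult y x = mult x y"
  "mult z y = mult y z"
  "mult z x = mult x z"
  "mult (mult x y) x = mult x (mult x y)"
  "mult (mult x y) y = mult y (mult x y)"
  "mult (mult x y) z = mult z (mult x y)"
  "mult (mult y z) x = mult x (mult y z)"
  "mult (mult y z) y = mult y (mult y z)"
  "mult (mult y z) z = mult z (mult y z)"
  "mult (mult x z) x = mult x (mult x z)"
  "mult (mult x z) y = mult y (mult x z)"
  "mult (mult x z) z = mult z (mult x z)"
  "mult (mult y z) (mult x y) = mult (mult x y) (mult y z)"
  "mult (mult x z) (mult x y) = mult (mult x y) (mult x z)"
  "mult (mult x z) (mult y z) = mult (mult y z) (mult x z)"
  "mult (mult x (mult y z)) x = mult x (mult x (mult y z))"
  "mult (mult x (mult y z)) y = mult y (mult x (mult y z))"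
  "mult (mult x (mult y z)) z = mult z (mult x (mult y z))"
  "mult (mult x (mult y z)) (mult x y) = mult (mult x y) (mult x (mult y z))"
  "mult (mult x (mult y z)) (mult y z) = mult (mult y z) (mult x (mult y z))"
  "mult (mult x (mult y z)) (mult x z) = mult (mult x z) (mult x (mult y z))"
  "mult (mult y (mult x z)) x = mult x (mult y (mult x z))"
  "mult (mult y (mult x z)) y = mult y (mult y (mult x z))"
  "mult (mult y (mult x z)) z = mult z (mult y (mult x z))"
  "mult (mult y (mult x z)) (mult x y) = mult (mult x y) (mult y (mult x z))"
  "mult (mult y (mult x z)) (mult y z) = mult (mult y z) (mult y (mult x z))"
  "mult (mult y (mult x z)) (mult x z) = mult (mult x z) (mult y (mult x z))"
  "mult (mult z (mult x y)) x = mult x (mult z (mult x y))"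
  "mult (mult z (mult x y)) y = mult y (mult z (mult x y))"
  "mult (mult z (mult x y)) z = mult z (mult z (mult x y))"
  "mult (mult z (mult x y)) (mult x y) = mult (mult x y) (mult z (mult x y))"
  "mult (mult z (mult x y)) (mult y z) = mult (mult y z) (mult z (mult x y))"
  "mult (mult z (mult x y)) (mult x z) = mult (mult x z) (mult z (mult x y))"
  "mult (mult y (mult x z)) (mult x (mult y z)) = mult (mult x (mult y z)) (mult y (mult x z))"
  "mult (mult z (mult x y)) (mult x (mult y z)) = mult (mult x (mult y z)) (mult z (mult x y))"
  "mult (mult z (mult x y)) (mult y (mult x z)) = mult (mult y (mult x z)) (mult z (mult x y))"
  by (rule mult_commute)+

text \<open>Of the 27 values of an axis on a word, four are the parameters themselves; these are the
  other 23.\<close>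

lemma form_values:
  "form x x = 1"
  "form y y = 1"
  "form z z = 1"
  "form y x = form x y"
  "form z y = form y z"
  "form z x = form x z"
  "form x (mult x y) = form x y"
  "form x (mult x z) = form x z"
  "form y (mult x y) = form x y"
  "form y (mult y z) = form y z"
  "form y (mult x z) = form x (mult y z)"
  "form z (mult x y) = form x (mult y z)"
  "form z (mult y z) = form y z"
  "form z (mult x z) = form x z"
  "form x (mult x (mult y z)) = form x (mult y z)"
  "form x (mult y (mult x z)) = (1/2) * (form x y * form x z + form x (mult y z))"
  "form x (mult z (mult x y)) = (1/2) * (form x y * form x z + form x (mult y z))"
  "form y (mult x (mult y z)) = (1/2) * (form x y * form y z + form x (mult y z))"
  "form y (mult y (mult x z)) = form x (mult y z)"
  "form y (mult z (mult x y)) = (1/2) * (form x y * form y z + form x (mult y z))"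
  "form z (mult x (mult y z)) = (1/2) * (form x z * form y z + form x (mult y z))"
  "form z (mult y (mult x z)) = (1/2) * (form x z * form y z + form x (mult y z))"
  "form z (mult z (mult x y)) = form x (mult y z)"
proof -
  note axes = x y z
  show "form x x = 1" "form y y = 1" "form z z = 1"
    using axes by (simp_all add: form_axis_self)
  show "form y x = form x y" "form z y = form y z" "form z x = form x z"
    by (rule form_commute)+
  note c = this
  show "form x (mult x y) = form x y" "form x (mult x z) = form x z" "form y (mult y z) = form y z"
    using axes by (simp_all add: form_axis_mult)
  show "form y (mult x y) = form x y" "form z (mult y z) = form y z" "form z (mult x z) = form x z"
    using axes by (metis form_axis_mult mult_commute form_commute)+
  show psi: "form y (mult x z) = form x (mult y z)" "form z (mult x y) = form x (mult y z)"
    by (metis form_rotate mult_commute)+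
  show "form x (mult x (mult y z)) = form x (mult y z)"
    "form y (mult y (mult x z)) = form x (mult y z)" "form z (mult z (mult x y)) = form x (mult y z)"
    using axes by (simp_all add: form_axis_mult psi)
  \<comment> \<open>By associativity the left side is (uv, uw).\<close>
  have r: "form u (mult v (mult u w)) = (1/2) * (form u v * form u w + form u (mult v w))"
    if "primitive_axis u" for u v w
    using form_mult_axis[OF that, of v w] by (metis form_assoc mult_commute)
  show "form x (mult y (mult x z)) = (1/2) * (form x y * form x z + form x (mult y z))"
   "form x (mult z (mult x y)) = (1/2) * (form x y * form x z + form x (mult y z))"
   "form y (mult x (mult y z)) = (1/2) * (form x y * form y z + form x (mult y z))"
   "form y (mult z (mult x y)) = (1/2) * (form x y * form y z + form x (mult y z))"
   "form z (mult x (mult y z)) = (1/2) * (form x z * form y z + form x (mult y z))"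
   "form z (mult y (mult x z)) = (1/2) * (form x z * form y z + form x (mult y z))"
    using r[OF x, of y z] r[OF x, of z y] r[OF y, of x z] r[OF y, of z x] r[OF z, of x y] r[OF z, of y x]
    by (simp_all only: orient psi c mult.commute)
qed

lemmas axis_products = axis_idem[OF x] axis_idem[OF y] axis_idem[OF z]
  axis_absorb[OF x] axis_absorb[OF y] axis_absorb[OF z]
  axis_absorb[OF y, of x] axis_absorb[OF z, of x] axis_absorb[OF z, of y]
  axis_mult_mult[OF x, of y z] axis_mult_mult[OF x, of z y]
  axis_mult_mult[OF y, of x z] axis_mult_mult[OF y, of z x]
  axis_mult_mult[OF z, of x y] axis_mult_mult[OF z, of y x]
  axis_mult_prod[OF x, of y z] axis_mult_prod[OF y, of x z] axis_mult_prod[OF z, of x y]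
  axis_mult_prod[OF x, of y y] axis_mult_prod[OF y, of z z] axis_mult_prod[OF x, of z z]
lemmas axis_rules = axis_products[unfolded orient] mult_linear orient form_linear form_values

text \<open>In \<open>axis_mult_prod\<close> with v = y and w = yz, every term on the right is a
  product already known from \<open>axis_absorb\<close> and \<open>axis_fusion\<close>.\<close>

lemma prod_7: "mult (mult x y) (mult x (mult y z)) =
  scale (1/8) (scale (form x y * form y z + form x (mult y z)) x + scale (form x (mult y z)) y
    + scale (2 * form x (mult y z)) (mult x y) + scale (form x y) (mult y z)
    + scale (2 * form x y) (mult x (mult y z)))"
  unfolding axis_mult_prod[OF x, of y "mult y z"]
  by (rule vector_eqI; simp only: axis_rules; simp (no_asm) add: field_simps numeral_simps)

text \<open>Supplies the coefficient of \<open>x\<close> that \<open>axis_absorb\<close> needs in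
  \<open>prod_8\<close>. Moving factors across the form reduces it to x(xy) and to (z, xy \<cdot>
  xy).\<close>

lemma form_prod_8: "form x (mult (mult x y) (mult z (mult x y)))
    = (1/8) * form x y * (2 * form x y * form x z + form x z + form y z + 4 * form x (mult y z))"
proof -
  have "form x (mult (mult x y) (mult z (mult x y))) = form (mult x (mult x y)) (mult z (mult x y))"
    by (simp add: form_assoc)
  also have "\<dots> = (1/2) * (form x y * form x (mult z (mult x y)) + form (mult x y) (mult z (mult x y)))"
    by (simp add: axis_absorb[OF x] form_linear)
  also have "form (mult x y) (mult z (mult x y)) = form z (mult (mult x y) (mult x y))"
    by (metis form_rotate mult_commute)
  finally show ?thesis
    by (simp only: axis_rules; simp (no_asm) add: field_simps numeral_simps)
qed

lemma prod_8: "mult (mult x y) (mult z (mult x y)) =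
    scale (1/8) (scale (form x y * form y z) x + scale (form x y * form x z) y
      + scale (4 * form x (mult y z)) (mult x y) + scale (form x y) (mult y z) + scale (form x y) (mult x z)
      - scale (2 * form x y) (mult x (mult y z)) - scale (2 * form x y) (mult y (mult x z))
      + scale (4 * form x y) (mult z (mult x y)))" (is "?T = ?R")
proof -
  txt \<open>By \<open>axis_mult_mult\<close>, the product \<open>T\<close> satisfies \<open>xT = T / 4 + K\<close> with \<open>K\<close> in the span of the
    nine words; comparing with the value of \<open>x(xT)\<close> from \<open>axis_absorb\<close> gives \<open>T\<close>.\<close>
  let ?Z = "mult z (mult x y)"
  define F where "F = scale (1/4) (scale (form x (mult ?Z y)) x + scale (form x y) (mult x ?Z)
    + scale (form x ?Z) (mult x y) + mult x (mult ?Z y) + ?T - mult y (mult x ?Z))"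
  have E: "mult x ?T = F"
    using axis_mult_mult[OF x, of ?Z y] by (simp only: F_def orient)
  have "mult x F = scale (1/2) (scale (form x ?T) x + F)"
    using axis_absorb[OF x, of ?T] by (simp only: E)
  \<comment> \<open>\<open>T\<close> has coefficient 1/16 in xF and 1/8 in F / 2; the factor -16
    turns the difference -1/16 into 1.\<close>
  moreover have "?T - ?R = scale (-16) (mult x F - scale (1/2) (scale (form x ?T) x + F))"
    by (rule vector_eqI; simp only: form_prod_8 F_def axis_rules E; simp (no_asm) add: field_simps numeral_simps)
  ultimately show ?thesis by simp
qed

end

context
  fixes x y z :: 'a
  assumes x: "primitive_axis x" and y: "primitive_axis y" and z: "primitive_axis z"
begin

text \<open>Outside the context that fixed the axes, the two products can be instantiated at all
  orders of the axes; \<open>prod_8\<close> is symmetric in its first two, so three orders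
  suffice.\<close>

lemmas prod_7_8_perms =
  prod_7[OF x y z] prod_7[OF y x z] prod_7[OF x z y] prod_7[OF z x y] prod_7[OF y z x] prod_7[OF z y x]
  prod_8[OF x y z] prod_8[OF y z x] prod_8[OF x z y]
lemmas product_rules = prod_7_8_perms[unfolded orient[OF x y z] form_values[OF x y z]] axis_rules[OF x y z]

text \<open>With v = w = yz, \<open>axis_mult_prod\<close> leaves yz \<cdot> yz and yz \<cdot>
  x(yz), the latter an instance of \<open>prod_8\<close>.\<close>

lemma prod_9: "mult (mult x (mult y z)) (mult x (mult y z)) =
    scale (1/16) (scale (form y z * (form x y + form x z + 2 * form x (mult y z))) x
        + scale (form y z * form x z) y + scale (form y z * form x y) z
        + scale (4 * form x (mult y z)) (mult y z) + scale (2 * form y z + 8 * form x (mult y z)) (mult x (mult y z))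
        - scale (2 * form y z) (mult y (mult x z)) - scale (2 * form y z) (mult z (mult x y)))"
  unfolding axis_mult_prod[OF x, of "mult y z" "mult y z"]
  by (rule vector_eqI; simp only: product_rules; simp (no_asm) add: field_simps numeral_simps)

end

context
  fixes x y z :: 'a
  assumes x: "primitive_axis x" and y: "primitive_axis y" and z: "primitive_axis z"
begin

lemmas product_rules' = prod_9[OF y x z, unfolded orient[OF x y z] form_values[OF x y z]] product_rules[OF x y z]

lemma prod_10: "mult (mult x (mult y z)) (mult y (mult x z)) =
    scale (1/16) (scale (form y z * (form x z + form x (mult y z))) x
      + scale (form x z * (form y z + form x (mult y z))) y
      + scale (form x y * form x (mult y z)) z + scale (2 * form x (mult y z)) (mult x y)
      + scale (2 * (form x y * form x z + form x (mult y z))) (mult y z)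
      + scale (2 * (form x y * form y z + form x (mult y z))) (mult x z)
      + scale (4 * form x (mult y z) - form x y + form y z - form x z) (mult x (mult y z))
      + scale (4 * form x (mult y z) - form x y - form y z + form x z) (mult y (mult x z))
      + scale (form x y - form y z - form x z - 4 * form x (mult y z)) (mult z (mult x y)))"
    (is "?P = ?R")
proof -
  txt \<open>Expand \<open>yZ \<cdot> yr\<close> by \<open>axis_mult_prod\<close>, where \<open>Z = z(xy)\<close> and \<open>r = xz\<close>. As \<open>yZ\<close> contains
    \<open>(yr + Z - x(yz)) / 4\<close>, the unknown products \<open>Z \<cdot> yr\<close> on both sides cancel and \<open>x(yz) \<cdot> yr\<close>
    is left.\<close>
  let ?Z = "mult z (mult x y)" and ?r = "mult x z"
  let ?E = "scale (1/4) (scale (form y (mult ?Z ?r)) y + scale (form y ?r) (mult y ?Z)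
    + scale (form y ?Z) (mult y ?r) - mult y (mult ?Z ?r) + mult ?Z (mult y ?r) + mult ?r (mult y ?Z))"
  have "mult (mult y ?Z) (mult y ?r) - ?E = 0"
    by (simp add: axis_mult_prod[OF y, of ?Z ?r])
  \<comment> \<open>The term -x(yz) / 4 of yZ gives \<open>?P\<close> the coefficient -1/4; the
    square of yr comes from \<open>prod_9\<close>.\<close>
  moreover have "?P - ?R = scale (-4) (mult (mult y ?Z) (mult y ?r) - ?E)"
    by (rule vector_eqI; simp only: product_rules'; simp (no_asm) add: field_simps numeral_simps)
  ultimately show ?thesis by simp
qed

end

end

section \<open>The homomorphism from the nine-dimensional algebra\<close>

lemma distinct_letters:
  "distinct [a, next_letter a, next_letter (next_letter a)]"
  "distinct [next_letter a, next_letter (next_letter a), a]"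
  "a \<noteq> b \<Longrightarrow> distinct [a, b, third a b]"
  "a \<noteq> b \<Longrightarrow> distinct [a, third a b, b]"
  "a \<noteq> b \<Longrightarrow> distinct [third a b, b, a]"
  "a \<noteq> b \<Longrightarrow> distinct [b, third a b, a]"
  by (cases a; cases b; simp add: third_def)+

context algebra_with_symmetric_form begin

text \<open>The case v = w = y of \<open>axis_mult_prod\<close>, with y(xy) evaluated by
  \<open>axis_absorb\<close> for the axis \<open>y\<close>.\<close>

lemma prod_5:
  assumes x: "primitive_axis x" and y: "primitive_axis y"
  shows "mult (mult x y) (mult x y) = scale (form x y / 4) (x + y) + scale (form x y / 2) (mult x y)"
proof -
  have yx: "mult y (mult x y) = scale (1/2) (scale (form x y) y + mult x y)"
    using axis_absorb[OF y, of x] by (simp only: mult_commute[of y x] form_commute[of y x])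
  show ?thesis
    unfolding axis_mult_prod[OF x, of y y] yx axis_idem[OF y]
    by (rule vector_eqI; simp only:; simp (no_asm) add: field_simps numeral_simps)
qed

context
  fixes g :: "letter \<Rightarrow> 'a" and \<alpha> \<beta> \<gamma> \<psi> :: 'f
  assumes g: "primitive_axis (g a)"
    and \<alpha>: "form (g La) (g Lb) = \<alpha>" and \<beta>: "form (g Lb) (g Lc) = \<beta>"
    and \<gamma>: "form (g La) (g Lc) = \<gamma>" and \<psi>: "form (g La) (mult (g Lb) (g Lc)) = \<psi>"
begin

definition symb_val :: "symb \<Rightarrow> 'a" where
  "symb_val s = (case s of Single x \<Rightarrow> g x
     | Pair_without w \<Rightarrow> mult (g (next_letter w)) (g (next_letter (next_letter w)))
     | Triple x \<Rightarrow> mult (g x) (mult (g (next_letter x)) (g (next_letter (next_letter x)))))"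

text \<open>The map that turns out to be the surjective homomorphism.\<close>

definition lin_ext :: "'f ^ symb \<Rightarrow> 'a" where
  "lin_ext v = (\<Sum>i\<in>UNIV. scale (v $ i) (symb_val i))"

lemma lin_ext_add: "lin_ext (u + v) = lin_ext u + lin_ext v"
  by (simp add: lin_ext_def scale_left_distrib sum.distrib)

lemma lin_ext_diff: "lin_ext (u - v) = lin_ext u - lin_ext v"
  by (simp add: lin_ext_def scale_left_diff_distrib sum_subtractf)

lemma lin_ext_scale: "lin_ext (c *s v) = scale c (lin_ext v)"
  by (simp add: lin_ext_def scale_sum_right)

lemma lin_ext_axis: "lin_ext (axis i 1) = symb_val i"
proof -
  have "lin_ext (axis i 1) = (\<Sum>j\<in>UNIV. if j = i then symb_val j else 0)"
    unfolding lin_ext_def by (intro sum.cong refl) (simp add: axis_def)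
  thus ?thesis by simp
qed

lemma linear_lin_ext: "Vector_Spaces.linear (*s) scale lin_ext"
  by unfold_locales (simp_all add: lin_ext_add lin_ext_scale vec.scale_right_distrib vec.scale_left_distrib)

lemma symb_val_pair: "distinct [x, y, z] \<Longrightarrow> symb_val (Pair_without z) = mult (g x) (g y)"
  by (cases x; cases y; cases z) (simp_all add: symb_val_def mult_commute)

lemma symb_val_triple: "distinct [x, y, z] \<Longrightarrow> symb_val (Triple x) = mult (g x) (mult (g y) (g z))"
  by (cases x; cases y; cases z) (simp_all add: symb_val_def mult_commute)

lemma symb_val_single: "symb_val (Single x) = g x"
  by (simp add: symb_val_def)

lemma lam_eq: "x \<noteq> y \<Longrightarrow> lam \<alpha> \<beta> \<gamma> x y = form (g x) (g y)"
  using \<alpha> \<beta> \<gamma> by (cases x; cases y) (simp_all add: lam_values form_commute)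

text \<open>Cyclic rotation and commutativity generate all permutations of the three axes.\<close>

lemma psi_eq: "distinct [x, y, z] \<Longrightarrow> \<psi> = form (g x) (mult (g y) (g z))"
  using \<psi> form_rotate[of "g La" "g Lb" "g Lc"] form_rotate[of "g La" "g Lc" "g Lb"]
  by (cases x; cases y; cases z) (simp_all add: mult_commute)

definition hom_at :: "symb \<Rightarrow> symb \<Rightarrow> bool" where
  "hom_at i j \<longleftrightarrow> lin_ext (prod9 \<alpha> \<beta> \<gamma> \<psi> (axis i 1)
     (axis j 1)) = mult (symb_val i) (symb_val j)"

lemma hom_at_commute: "hom_at i j \<Longrightarrow> hom_at j i"
  unfolding hom_at_def by (metis prod9_commute mult_commute)

context
  fixes x y z :: letter
  assumes d: "distinct [x, y, z]"
begin

text \<open>A generic order of the letters stands for all permutations. Once the parameters are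
  translated, the tables of symbols and of words have identical right-hand sides.\<close>

lemma hom_at_letters:
  "hom_at (Single x) (Single x)" "hom_at (Single x) (Single y)"
  "hom_at (Single x) (Pair_without x)" "hom_at (Single x) (Pair_without z)"
  "hom_at (Single x) (Triple x)" "hom_at (Single x) (Triple y)"
  "hom_at (Pair_without z) (Pair_without z)" "hom_at (Pair_without z) (Pair_without y)"
  "hom_at (Pair_without z) (Triple x)" "hom_at (Pair_without z) (Triple z)"
  "hom_at (Triple x) (Triple x)" "hom_at (Triple x) (Triple y)"
proof -
  have d': "distinct [y, z, x]" "distinct [x, z, y]" "distinct [y, x, z]" "distinct [z, x, y]"
    using d by auto
  have val: "symb_val (Pair_without z) = mult (g x) (g y)" "symb_val (Pair_without x) = mult (g y) (g z)"
    "symb_val (Pair_without y) = mult (g x) (g z)" "symb_val (Triple x) = mult (g x) (mult (g y) (g z))"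
    "symb_val (Triple y) = mult (g y) (mult (g x) (g z))" "symb_val (Triple z) = mult (g z) (mult (g x) (g y))"
    "symb_val (Single w) = g w" for w
    by (rule symb_val_pair[OF d] symb_val_pair[OF d'(1)] symb_val_pair[OF d'(2)] symb_val_triple[OF d]
        symb_val_triple[OF d'(3)] symb_val_triple[OF d'(4)] symb_val_single)+
  have th: "third x y = z" "third y z = x" "third x z = y"
    using d d' by (simp_all only: third_distinct)
  have lm: "lam \<alpha> \<beta> \<gamma> x y = form (g x) (g y)" "lam \<alpha> \<beta> \<gamma> y z = form (g y) (g z)"
     "lam \<alpha> \<beta> \<gamma> x z = form (g x) (g z)"
    using d by (simp_all add: lam_eq)
  have ps: "form (g x) (mult (g y) (g z)) = \<psi>" using psi_eq[OF d] by simp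
  note p9 = prod9_1[OF d, of \<alpha> \<beta> \<gamma> \<psi>, unfolded th lm]
     prod9_2[OF d, of \<alpha> \<beta> \<gamma> \<psi>, unfolded th lm]
     prod9_3[OF d, of \<alpha> \<beta> \<gamma> \<psi>, unfolded th lm]
     prod9_4[OF d, of \<alpha> \<beta> \<gamma> \<psi>, unfolded th lm]
     prod9_5[OF d, of \<alpha> \<beta> \<gamma> \<psi>, unfolded th lm]
     prod9_6[OF d, of \<alpha> \<beta> \<gamma> \<psi>, unfolded th lm]
     prod9_7[OF d, of \<alpha> \<beta> \<gamma> \<psi>, unfolded th lm]
     prod9_8[OF d, of \<alpha> \<beta> \<gamma> \<psi>, unfolded th lm]
     prod9_9[OF d, of \<alpha> \<beta> \<gamma> \<psi>, unfolded th lm]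
     prod9_10[OF d, of \<alpha> \<beta> \<gamma> \<psi>, unfolded th lm]
  note pr = axis_idem[OF g] axis_absorb[OF g]
    axis_mult_mult[OF g[of x], of "g y" "g z"] prod_5[OF g g] axis_mult_prod[OF g[of x], of "g y" "g z"]
    prod_7[OF g[of x] g[of y] g[of z]] prod_8[OF g[of x] g[of y] g[of z]]
    prod_9[OF g[of x] g[of y] g[of z]] prod_10[OF g[of x] g[of y] g[of z]]
  show "hom_at (Single x) (Single x)" "hom_at (Single x) (Single y)"
  "hom_at (Single x) (Pair_without x)" "hom_at (Single x) (Pair_without z)"
  "hom_at (Single x) (Triple x)" "hom_at (Single x) (Triple y)"
  "hom_at (Pair_without z) (Pair_without z)" "hom_at (Pair_without z) (Pair_without y)"
  "hom_at (Pair_without z) (Triple x)" "hom_at (Pair_without z) (Triple z)"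
  "hom_at (Triple x) (Triple x)" "hom_at (Triple x) (Triple y)"
    unfolding hom_at_def
    by (simp_all only: p9 lin_ext_add lin_ext_diff lin_ext_scale lin_ext_axis val pr ps)
qed

end

lemma hom_at: "hom_at i j"
proof -
  \<comment> \<open>By commutativity it suffices to take single letters before pairs and pairs
    before triples.\<close>
  have "hom_at i j \<or> hom_at j i"
  proof -
    \<comment> \<open>For equal letters, \<open>1\<close> puts \<open>a\<close> in the role of x or
      z; for distinct ones, \<open>2\<close> puts \<open>a\<close> and \<open>b\<close> in the two
      positions that an identity uses.\<close>
    note 1 = hom_at_letters[OF distinct_letters(1)]
      hom_at_letters[OF distinct_letters(2)]
    note 2 = hom_at_letters[OF distinct_letters(3)]
      hom_at_letters[OF distinct_letters(4)]
      hom_at_letters[OF distinct_letters(5)]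
      hom_at_letters[OF distinct_letters(6)]
    have "hom_at (Single a) (Single b)" "hom_at (Single a) (Pair_without b)"
      "hom_at (Single a) (Triple b)" "hom_at (Pair_without a) (Pair_without b)"
      "hom_at (Pair_without a) (Triple b)" "hom_at (Triple a) (Triple b)" for a b
      by (cases "a = b"; blast intro: 1 2)+
    thus ?thesis by (cases i; cases j; simp)
  qed
  thus ?thesis using hom_at_commute by blast
qed

lemma lin_ext_prod9: "lin_ext (prod9 \<alpha> \<beta> \<gamma> \<psi> u v) = mult (lin_ext u) (lin_ext v)"
proof -
  interpret h: Vector_Spaces.linear "(*s)" scale lin_ext by (rule linear_lin_ext)
  have "lin_ext (prod9 \<alpha> \<beta> \<gamma> \<psi> u v)
      = (\<Sum>i\<in>UNIV. \<Sum>j\<in>UNIV. scale (u $ i * v $ j) (lin_ext (basis_prod \<alpha> \<beta> \<gamma> \<psi> i j)))"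
    by (simp add: prod9_def h.sum lin_ext_scale)
  also have "\<dots> = (\<Sum>i\<in>UNIV. \<Sum>j\<in>UNIV. scale (u $ i * v $ j) (mult (symb_val i) (symb_val j)))"
    using hom_at by (simp add: hom_at_def prod9_axis)
  also have "\<dots> = mult (lin_ext u) (lin_ext v)"
    by (subst sum.swap)
      (simp add: lin_ext_def mult_sum_left mult_sum_right mult_scale_left mult_scale_right
        scale_sum_right mult.commute)
  finally show ?thesis .
qed

text \<open>The range of a homomorphism is a subalgebra, and this one contains the
  generators.\<close>

lemma surj_lin_ext:
  assumes "generates (range g)"
  shows "surj lin_ext"
proof -
  interpret h: Vector_Spaces.linear "(*s)" scale lin_ext by (rule linear_lin_ext)
  have "subalgebra (range lin_ext)"
    unfolding subalgebra_def mult_sets_def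
    by (auto simp: h.subspace_image lin_ext_prod9[symmetric])
  moreover have "range g \<subseteq> range lin_ext"
  proof
    fix v assume "v \<in> range g"
    then obtain a where "v = lin_ext (axis (Single a) 1)"
      by (auto simp: lin_ext_axis symb_val_single)
    thus "v \<in> range lin_ext" by blast
  qed
  ultimately have "subalgebra hull (range g) \<subseteq> range lin_ext"
    by (rule hull_minimal[rotated])
  thus ?thesis using assms by (auto simp: generates_def)
qed

lemma homomorphic_image_prod9:
  assumes "generates (range g)"
  shows "homomorphic_image scale mult (*s) (prod9 \<alpha> \<beta> \<gamma> \<psi>)"
  unfolding homomorphic_image_def
  using linear_lin_ext lin_ext_prod9 surj_lin_ext[OF assms] by blast

end

end

section \<open>Application to an axial algebra with three generating axes\<close>

theorem proposition5:
  fixes scale :: "'f::field \<Rightarrow> 'a::ab_group_add \<Rightarrow> 'a"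
    and mult :: "'a \<Rightarrow> 'a \<Rightarrow> 'a"
    and form :: "'a \<Rightarrow> 'a \<Rightarrow> 'f"
    and x0 y0 z0 :: 'a
    and \<alpha> \<beta> \<gamma> \<psi> :: 'f
  assumes "CHAR('f) \<noteq> 2"
    and "comm_algebra scale mult"
    and "comm_algebra.primitive_axial_algebra_jordan scale mult (1/2) {x0, y0, z0}"
    and "comm_algebra.the_frobenius_form scale mult (1/2) {x0, y0, z0} form"
    and "form x0 y0 = \<alpha>"
    and "form y0 z0 = \<beta>"
    and "form x0 z0 = \<gamma>"
    and "form x0 (mult y0 z0) = \<psi>"
  shows "homomorphic_image scale mult (*s) (prod9 \<alpha> \<beta> \<gamma> \<psi>)"
proof -
  interpret comm_algebra scale mult by fact
  have two: "(2::'f) \<noteq> 0"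
  proof
    assume "(2::'f) = 0"
    hence "of_nat 2 = (0::'f)" by simp
    hence "CHAR('f) dvd 2" by (simp only: of_nat_eq_0_iff_char_dvd)
    \<comment> \<open>A divisor of the prime 2 other than 2 is 1, and no field has characteristic
      1.\<close>
    hence "CHAR('f) = 1" using assms(1) by (metis prime_nat_iff two_is_prime_nat)
    thus False by simp
  qed
  have form: "frobenius_form form" "\<And>u. u \<in> {x0, y0, z0} \<Longrightarrow> form u u = 1"
    using assms(4) unfolding the_frobenius_form_def by (elim conjE; blast)+
  interpret algebra_with_form scale mult form
    using form(1) two comm_algebra_axioms
    by (simp add: frobenius_form_def algebra_with_form_def algebra_with_form_axioms_def)
  have gen: "generates {x0, y0, z0}" and ax: "\<And>u. u \<in> {x0, y0, z0} \<Longrightarrow> primitive_axis u"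
    using assms(3) form(2)
    unfolding primitive_axial_algebra_jordan_def axial_algebra_jordan_def primitive_axis_def by blast+
  interpret algebra_with_symmetric_form scale mult form
    by unfold_locales (rule form_commute_if_generated[OF gen ax])
  define g where "g = case_letter x0 y0 z0"
  have g: "g La = x0" "g Lb = y0" "g Lc = z0" by (simp_all add: g_def)
  hence "range g = {x0, y0, z0}" by (simp add: UNIV_letter)
  moreover have "primitive_axis (g a)" for a by (cases a) (simp_all add: g ax)
  ultimately show ?thesis
    using homomorphic_image_prod9[of g \<alpha> \<beta> \<gamma> \<psi>] gen assms(5-8) by (simp add: g)
qed

end
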